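(* Let $R$ be an integral domain that is not a field. If the set of units $R^\times$ is not open in $M(R)$ and $R$ is a Furstenberg domain, then $R$ has an infinite number of (pairwise) non-associated irreducible elements. Hence, $R$ cannot be a Cohen-Kaplansky domain.
   Context: For $X\subset R$, $X^0=X\setminus\{0\}$; $\langle r\rangle$ is the ideal of $R$ generated by $r$. For $r\in R$ let $\sigma_r=\{s\in R:\langle r\rangle+\langle s\rangle=R\}$. The Macías space $M(R)$ is the set $R^0$ with the topology having the basis $\{\sigma_k^0: k\in R^0\}$. A Furstenberg domain is an integral domain in which every nonzero nonunit is divisible by an irreducible element. A Cohen-Kaplansky domain is an atomic domain (every nonzero nonunit is a finite product of irreducible elements) having only finitely many irreducible elements up to associates. *)

theory Defs
  imports "HOL-Analysis.Abstract_Topology" "HOL-Algebra.Ring_Divisibility"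
begin

definition comax :: "('a, 'b) ring_scheme \<Rightarrow> 'a \<Rightarrow> 'a set" where
  "comax R r =
     {s \<in> carrier R. Idl\<^bsub>R\<^esub> {r} <+>\<^bsub>R\<^esub> Idl\<^bsub>R\<^esub> {s} = carrier R}"

definition macias_basis :: "('a, 'b) ring_scheme \<Rightarrow> 'a set set" where
  "macias_basis R = {comax R k - {\<zero>\<^bsub>R\<^esub>} |k. k \<in> carrier R - {\<zero>\<^bsub>R\<^esub>}}"

text \<open>
  The open sets are the unions of basic sets. That this is a topology on the nonzero elements,
  when the ring is a domain, is shown in \<open>openin_macias_space\<close> and \<open>topspace_macias_space\<close> below.
\<close>

definition macias_space :: "('a, 'b) ring_scheme \<Rightarrow> 'a topology" where
  "macias_space R = topology (arbitrary union_of (\<lambda>U. U \<in> macias_basis R))"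

definition irreducibles :: "('a, 'b) ring_scheme \<Rightarrow> 'a set" where
  "irreducibles R = {p \<in> carrier R. ring_irreducible\<^bsub>R\<^esub> p}"

definition furstenberg_domain :: "('a, 'b) ring_scheme \<Rightarrow> bool" where
  "furstenberg_domain R \<longleftrightarrow> domain R \<and>
     (\<forall>a \<in> carrier R - {\<zero>\<^bsub>R\<^esub>} - Units R. \<exists>p \<in> irreducibles R. p divides\<^bsub>R\<^esub> a)"

definition atomic_domain :: "('a, 'b) ring_scheme \<Rightarrow> bool" where
  "atomic_domain R \<longleftrightarrow> domain R \<and>
     (\<forall>a \<in> carrier R - {\<zero>\<^bsub>R\<^esub>} - Units R.
        \<exists>ps. set ps \<subseteq> irreducibles R \<and> foldr (\<otimes>\<^bsub>R\<^esub>) ps \<one>\<^bsub>R\<^esub> = a)"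

definition cohen_kaplansky_domain :: "('a, 'b) ring_scheme \<Rightarrow> bool" where
  "cohen_kaplansky_domain R \<longleftrightarrow> atomic_domain R \<and>
     (\<exists>F. finite F \<and> F \<subseteq> irreducibles R \<and> (\<forall>p \<in> irreducibles R. \<exists>q \<in> F. p \<sim>\<^bsub>R\<^esub> q))"

lemma (in cring) comax_iff:
  assumes "r \<in> carrier R"
  shows "s \<in> comax R r \<longleftrightarrow>
    s \<in> carrier R \<and> (\<exists>x \<in> carrier R. \<exists>y \<in> carrier R. x \<otimes> r \<oplus> y \<otimes> s = \<one>)"
proof (cases "s \<in> carrier R")
  case True
  let ?I = "Idl {r} <+>\<^bsub>R\<^esub> Idl {s}"
  have ideal: "ideal ?I R"
    using assms True by (intro add_ideals genideal_ideal) auto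
  have I_eq: "?I = (\<Union>h \<in> PIdl r. \<Union>k \<in> PIdl s. {h \<oplus> k})"
    by (simp only: set_add_def' cgenideal_eq_genideal[OF assms] cgenideal_eq_genideal[OF True])
  have "?I = carrier R \<longleftrightarrow> \<one> \<in> ?I"
    using ideal.one_imp_carrier[OF ideal] by auto
  also have "\<dots> \<longleftrightarrow> (\<exists>x \<in> carrier R. \<exists>y \<in> carrier R. x \<otimes> r \<oplus> y \<otimes> s = \<one>)"
    unfolding I_eq cgenideal_def by (simp add: Bex_def) metis
  finally show ?thesis
    using True by (simp add: comax_def)
qed (simp add: comax_def)

lemma (in cring) comaxI:
  assumes "r \<in> carrier R" "s \<in> carrier R" "x \<in> carrier R" "y \<in> carrier R"
    and "x \<otimes> r \<oplus> y \<otimes> s = \<one>"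
  shows "s \<in> comax R r"
  using assms by (subst comax_iff) blast+

lemma (in cring) comax_mult:
  assumes k: "k \<in> carrier R" and l: "l \<in> carrier R"
  shows "comax R (k \<otimes> l) = comax R k \<inter> comax R l"
proof (intro equalityI subsetI)
  fix s assume "s \<in> comax R (k \<otimes> l)"
  then obtain x y where s: "s \<in> carrier R" and xy: "x \<in> carrier R" "y \<in> carrier R"
    and eq: "x \<otimes> (k \<otimes> l) \<oplus> y \<otimes> s = \<one>"
    using k l by (auto simp: comax_iff)
  have "(x \<otimes> l) \<otimes> k \<oplus> y \<otimes> s = \<one>" "(x \<otimes> k) \<otimes> l \<oplus> y \<otimes> s = \<one>"
    using eq k l xy by (simp_all add: m_ac)
  then show "s \<in> comax R k \<inter> comax R l"
    using s k l xy by (simp add: comaxI[of _ _ "x \<otimes> l" y] comaxI[of _ _ "x \<otimes> k" y])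
next
  fix s assume "s \<in> comax R k \<inter> comax R l"
  then obtain x y x' y' where s: "s \<in> carrier R"
    and xy: "x \<in> carrier R" "y \<in> carrier R" "x' \<in> carrier R" "y' \<in> carrier R"
    and eq: "x \<otimes> k \<oplus> y \<otimes> s = \<one>" "x' \<otimes> l \<oplus> y' \<otimes> s = \<one>"
    using k l by (auto simp: comax_iff)
  have "(x \<otimes> x') \<otimes> (k \<otimes> l) \<oplus> (x \<otimes> k \<otimes> y' \<oplus> y) \<otimes> s
      = x \<otimes> k \<otimes> (x' \<otimes> l \<oplus> y' \<otimes> s) \<oplus> y \<otimes> s"
    using s k l xy by algebra
  then have "(x \<otimes> x') \<otimes> (k \<otimes> l) \<oplus> (x \<otimes> k \<otimes> y' \<oplus> y) \<otimes> s = \<one>"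
    using eq k xy by simp
  then show "s \<in> comax R (k \<otimes> l)"
    by (rule comaxI[rotated -1]) (use s k l xy in simp_all)
qed

lemma (in domain) openin_macias_space:
  "openin (macias_space R) = arbitrary union_of (\<lambda>U. U \<in> macias_basis R)"
proof -
  have "U \<inter> V \<in> macias_basis R" if UV: "U \<in> macias_basis R" "V \<in> macias_basis R" for U V
  proof -
    obtain k l where kl: "k \<in> carrier R - {\<zero>}" "l \<in> carrier R - {\<zero>}"
      and "U = comax R k - {\<zero>}" "V = comax R l - {\<zero>}"
      using UV by (auto simp: macias_basis_def)
    then have "U \<inter> V = comax R (k \<otimes> l) - {\<zero>}"
      by (auto simp: comax_mult)
    moreover have "k \<otimes> l \<in> carrier R - {\<zero>}"
      using kl integral by auto
    ultimately show ?thesis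
      unfolding macias_basis_def by blast
  qed
  then show ?thesis
    unfolding macias_space_def
    by (intro topology_inverse' istopology_base) auto
qed

lemma (in domain) topspace_macias_space: "topspace (macias_space R) = carrier R - {\<zero>}"
proof
  show "topspace (macias_space R) \<subseteq> carrier R - {\<zero>}"
    by (auto simp: topspace_def openin_macias_space union_of_def arbitrary_def
        macias_basis_def comax_def)
  have "s \<in> comax R \<one>" if s: "s \<in> carrier R" for s
  proof -
    have "\<one> \<otimes> \<one> \<oplus> \<zero> \<otimes> s = \<one>"
      using s by simp
    then show ?thesis
      by (rule comaxI[rotated -1]) (use s in simp_all)
  qed
  then have "carrier R - {\<zero>} = comax R \<one> - {\<zero>}"
    by (auto simp: comax_def)
  then have "openin (macias_space R) (carrier R - {\<zero>})"
    unfolding openin_macias_space macias_basis_def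
    by (intro arbitrary_union_of_inc) (use one_not_zero in blast)
  then show "carrier R - {\<zero>} \<subseteq> topspace (macias_space R)"
    by (rule openin_subset)
qed

end

theory Submission
  imports Defs
begin

text \<open>
  This is Furstenberg's proof of the infinitude of primes, carried out in the Macias topology.
  If finitely many irreducibles represented all of them up to associates, let \<open>k\<close> be a nonzero
  common multiple of these representatives. An element comaximal with \<open>k\<close> has only units in
  common with \<open>k\<close> as divisors, so no irreducible divides it; in a Furstenberg domain such an
  element, if nonzero, is a unit. Thus the basic open set given by \<open>k\<close> would be exactly the set
  of units, against the assumption that the latter is not open
  (\<open>units_open_if_finitely_many_irreducibles\<close>).

  Choosing one representative from each associate class of irreducibles gives pairwise
  non-associated elements, and by the above this choice cannot be finite. The same argument
  excludes the finite set of representatives that a Cohen-Kaplansky domain has by definition.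
\<close>

lemma (in domain) finite_common_multiple:
  assumes "finite F" "F \<subseteq> carrier R - {\<zero>}"
  shows "\<exists>k \<in> carrier R - {\<zero>}. \<forall>q \<in> F. q divides k"
  using assms
proof (induction F rule: finite_induct)
  case empty
  show ?case
    by (intro bexI[of _ \<one>]) auto
next
  case (insert p F)
  then obtain k where k: "k \<in> carrier R - {\<zero>}" "\<forall>q \<in> F. q divides k"
    by auto
  have p: "p \<in> carrier R - {\<zero>}"
    using insert.prems by auto
  have "p \<otimes> k \<in> carrier R - {\<zero>}"
    using p k integral by auto
  moreover have "p divides p \<otimes> k"
    by (rule dividesI[of k]) (use k in simp_all)
  moreover have "q divides p \<otimes> k" if "q \<in> F" for q
    by (rule divides_prod_l) (use k p that insert.prems in auto)
  ultimately show ?case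
    by blast
qed

text \<open>
  A common divisor of \<open>k\<close> and \<open>s\<close> divides every combination of them, and comaximality says that
  \<open>\<one>\<close> is such a combination. This is how the topology detects divisors.
\<close>
lemma (in cring) comax_common_divisor_unit:
  assumes "k \<in> carrier R" "s \<in> comax R k"
    and q: "q \<in> carrier R" "q divides k" "q divides s"
  shows "q \<in> Units R"
proof -
  obtain x y where s: "s \<in> carrier R" and xy: "x \<in> carrier R" "y \<in> carrier R"
    and eq: "x \<otimes> k \<oplus> y \<otimes> s = \<one>"
    using assms(2) unfolding comax_iff[OF assms(1)] by blast
  obtain c d where cd: "c \<in> carrier R" "d \<in> carrier R" "k = q \<otimes> c" "s = q \<otimes> d"
    using q(2,3) unfolding factor_def by blast
  have "q \<otimes> (x \<otimes> c \<oplus> y \<otimes> d) = x \<otimes> k \<oplus> y \<otimes> s"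
    unfolding cd using q(1) xy cd(1,2) by algebra
  then have "q \<otimes> (x \<otimes> c \<oplus> y \<otimes> d) = \<one>"
    using eq by simp
  then have "q divides \<one>"
    by (intro dividesI[of "x \<otimes> c \<oplus> y \<otimes> d"]) (use xy cd(1,2) in simp_all)
  then show ?thesis
    using q(1) by (simp add: Unit_eq_dividesone)
qed

lemma (in cring) Units_subset_comax:
  assumes "k \<in> carrier R"
  shows "Units R \<subseteq> comax R k"
proof
  fix u assume u: "u \<in> Units R"
  then have "\<zero> \<otimes> k \<oplus> inv u \<otimes> u = \<one>"
    using assms by simp
  then show "u \<in> comax R k"
    by (rule comaxI[rotated -1]) (use u assms Units_closed[OF u] in simp_all)
qed

text \<open>
  The basic set of a nonzero common multiple \<open>k\<close> of \<open>F\<close> is the set of units: an irreducible divisor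
  of one of its elements would be associated to a member of \<open>F\<close>, and hence a nonunit divisor of
  \<open>k\<close> too.
\<close>
lemma units_open_if_finitely_many_irreducibles:
  fixes R (structure)
  assumes furst: "furstenberg_domain R"
    and F: "finite F" "F \<subseteq> irreducibles R" "\<forall>p \<in> irreducibles R. \<exists>q \<in> F. p \<sim> q"
  shows "openin (macias_space R) (Units R)"
proof -
  interpret domain R
    using furst by (simp add: furstenberg_domain_def)
  have "F \<subseteq> carrier R - {\<zero>}"
    using F(2) by (auto simp: irreducibles_def ring_irreducible_def)
  then obtain k where k: "k \<in> carrier R" "k \<noteq> \<zero>" and dvd_k: "\<And>q. q \<in> F \<Longrightarrow> q divides k"
    using finite_common_multiple[OF F(1)] by blast
  have "s \<in> Units R" if s: "s \<in> comax R k" "s \<noteq> \<zero>" for s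
  proof (rule ccontr)
    assume "s \<notin> Units R"
    moreover have s_carr: "s \<in> carrier R"
      using s by (simp add: comax_def)
    ultimately obtain p where p: "p \<in> irreducibles R" "p divides s"
      using furst s(2) by (auto simp: furstenberg_domain_def)
    then obtain q where q: "q \<in> F" "p \<sim> q"
      using F(3) by blast
    have carr: "p \<in> carrier R" "q \<in> carrier R" and "q \<notin> Units R"
      using p q F(2) by (auto simp: irreducibles_def ring_irreducible_def irreducible_def)
    have "q divides s"
      using divides_cong_l[OF associated_sym[OF q(2)] p(2) carr(2)] .
    then have "q \<in> Units R"
      using comax_common_divisor_unit[OF k(1) s(1) carr(2) dvd_k[OF q(1)]] by blast
    with \<open>q \<notin> Units R\<close> show False ..
  qed
  moreover have "\<zero> \<notin> Units R"
    using zero_not_one by (auto simp: Units_def)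
  ultimately have "Units R = comax R k - {\<zero>}"
    using Units_subset_comax[OF k(1)] by blast
  then have "Units R \<in> macias_basis R"
    using k by (auto simp: macias_basis_def)
  then show ?thesis
    unfolding openin_macias_space by (rule arbitrary_union_of_inc)
qed

lemma (in monoid) associate_representatives:
  assumes A: "A \<subseteq> carrier G"
  obtains S where "S \<subseteq> A" "\<forall>p \<in> A. \<exists>q \<in> S. p \<sim> q" "pairwise (\<lambda>p q. \<not> p \<sim> q) S"
proof -
  define rep where "rep p = (SOME q. q \<in> A \<and> p \<sim> q)" for p
  have rep: "rep p \<in> A \<and> p \<sim> rep p" if "p \<in> A" for p
    unfolding rep_def by (rule someI[of _ p]) (use that A in auto)
  have rep_eq: "rep p = rep q" if "p \<in> A" "q \<in> A" "p \<sim> q" for p q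
  proof -
    have "r \<in> A \<and> p \<sim> r \<longleftrightarrow> r \<in> A \<and> q \<sim> r" for r
      using associated_trans[of q p r] associated_trans[of p q r] associated_sym[OF that(3)]
        that A by blast
    then show ?thesis
      by (simp add: rep_def)
  qed
  have "p \<sim> q" if "p \<in> A" "q \<in> A" "rep p \<sim> rep q" for p q
    using associated_trans[of p "rep p" "rep q"] associated_trans[of p "rep q" q]
      associated_sym[of q "rep q"] rep[OF that(1)] rep[OF that(2)] that A by blast
  then have "pairwise (\<lambda>p q. \<not> p \<sim> q) (rep ` A)"
    using rep_eq unfolding pairwise_def by blast
  moreover have "rep ` A \<subseteq> A" "\<forall>p \<in> A. \<exists>q \<in> rep ` A. p \<sim> q"
    using rep by blast+
  ultimately show thesis
    using that by blast
qed

theorem theorem4p13: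
  fixes R :: "('a, 'b) ring_scheme"
  assumes "domain R"
    and "\<not> field R"
    and "\<not> openin (macias_space R) (Units R)"
    and "furstenberg_domain R"
  shows "(\<exists>S. S \<subseteq> irreducibles R \<and> infinite S \<and> pairwise (\<lambda>p q. \<not> p \<sim>\<^bsub>R\<^esub> q) S) \<and>
         \<not> cohen_kaplansky_domain R"
proof -
  interpret domain R
    by (rule assms)
  have no_finite: False
    if "finite F" "F \<subseteq> irreducibles R" "\<forall>p \<in> irreducibles R. \<exists>q \<in> F. p \<sim>\<^bsub>R\<^esub> q" for F
    using units_open_if_finitely_many_irreducibles[OF assms(4) that] assms(3) by blast
  have "irreducibles R \<subseteq> carrier R"
    by (auto simp: irreducibles_def)
  then obtain S where "S \<subseteq> irreducibles R" "\<forall>p \<in> irreducibles R. \<exists>q \<in> S. p \<sim>\<^bsub>R\<^esub> q"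
    "pairwise (\<lambda>p q. \<not> p \<sim>\<^bsub>R\<^esub> q) S"
    by (rule associate_representatives)
  then show ?thesis
    using no_finite unfolding cohen_kaplansky_domain_def by blast
qed

end
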